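(* Let $n$ be an even positive integer and $k$ an integer with $2\leq k\leq \frac{n}{2}-1$, and let $G$ be a connected balanced bipartite graph of order $n$. If $$\rho(G)\geq \rho\bigl(K_{\frac{n}{2},\frac{n}{2}}\backslash E(K_{1,\frac{n}{2}-k+1})\bigr),$$ then $G$ contains $k$ edge-disjoint perfect matchings, unless $G\cong K_{\frac{n}{2},\frac{n}{2}}\backslash E(K_{1,\frac{n}{2}-k+1})$.
   Context: All graphs are finite, simple and undirected. For a graph $G$, $\rho(G)$ denotes the spectral radius, i.e. the largest eigenvalue of its adjacency matrix. A bipartite graph with bipartition $(X,Y)$ is balanced if $|X|=|Y|$. $K_{p,q}$ is the complete bipartite graph with parts of sizes $p$ and $q$. For a subgraph $H$ of $G$, $G\backslash E(H)$ is the graph obtained from $G$ by deleting the edges of $H$ (keeping all vertices); thus $K_{\frac{n}{2},\frac{n}{2}}\backslash E(K_{1,\frac{n}{2}-k+1})$ is obtained from $K_{\frac n2,\frac n2}$ by deleting $\frac n2-k+1$ edges incident with one fixed vertex. *)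

theory Defs
  imports Complex_Main "HOL-Library.Disjoint_Sets" "Jordan_Normal_Form.Spectral_Radius"
begin

record 'a ugraph =
  verts :: "'a set"
  edges :: "'a set set"

definition simple_graph :: "'a ugraph \<Rightarrow> bool" where
  "simple_graph G \<longleftrightarrow> finite (verts G) \<and> (\<forall>e\<in>edges G. e \<subseteq> verts G \<and> card e = 2)"

definition connected_graph :: "'a ugraph \<Rightarrow> bool" where
  "connected_graph G \<longleftrightarrow> verts G \<noteq> {} \<and>
     (\<forall>u\<in>verts G. \<forall>v\<in>verts G. (u, v) \<in> {(x, y). {x, y} \<in> edges G}\<^sup>*)"

definition bipartition :: "'a ugraph \<Rightarrow> 'a set \<Rightarrow> 'a set \<Rightarrow> bool" where
  "bipartition G X Y \<longleftrightarrow> X \<union> Y = verts G \<and> X \<inter> Y = {} \<and>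
     (\<forall>e\<in>edges G. \<exists>x\<in>X. \<exists>y\<in>Y. e = {x, y})"

definition balanced_bipartite :: "'a ugraph \<Rightarrow> bool" where
  "balanced_bipartite G \<longleftrightarrow> (\<exists>X Y. bipartition G X Y \<and> card X = card Y)"

text \<open>
  The rows and columns of the adjacency matrix are ordered by an arbitrarily chosen enumeration
  of the vertices. Another choice conjugates the matrix by a permutation matrix, so the spectrum
  does not depend on it.
\<close>

definition vertex_enum :: "'a ugraph \<Rightarrow> nat \<Rightarrow> 'a" where
  "vertex_enum G = (SOME f. bij_betw f {..<card (verts G)} (verts G))"

definition adjacency_matrix :: "'a ugraph \<Rightarrow> real mat" where
  "adjacency_matrix G = mat (card (verts G)) (card (verts G))
     (\<lambda>(i, j). if {vertex_enum G i, vertex_enum G j} \<in> edges G then 1 else 0)"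

text \<open>
  The largest real eigenvalue; the adjacency matrix is symmetric, so all its eigenvalues are real.
\<close>

definition graph_spectral_radius :: "'a ugraph \<Rightarrow> real" where
  "graph_spectral_radius G = Max (spectrum (adjacency_matrix G))"

definition complete_bipartite :: "nat \<Rightarrow> nat \<Rightarrow> (nat + nat) ugraph" where
  "complete_bipartite p q =
     \<lparr>verts = {..<p} <+> {..<q}, edges = {{Inl i, Inr j} | i j. i < p \<and> j < q}\<rparr>"

text \<open>
  With the concrete vertices above, \<open>complete_bipartite p' q'\<close> is a subgraph of
  \<open>complete_bipartite p q\<close> whenever \<open>p' \<le> p\<close> and \<open>q' \<le> q\<close>.
\<close>

definition delete_edges_of :: "'a ugraph \<Rightarrow> 'a ugraph \<Rightarrow> 'a ugraph" where
  "delete_edges_of G H = \<lparr>verts = verts G, edges = edges G - edges H\<rparr>"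

definition graph_isomorphic :: "'a ugraph \<Rightarrow> 'b ugraph \<Rightarrow> bool" where
  "graph_isomorphic G H \<longleftrightarrow> (\<exists>f. bij_betw f (verts G) (verts H) \<and>
     (\<forall>u\<in>verts G. \<forall>v\<in>verts G. {u, v} \<in> edges G \<longleftrightarrow> {f u, f v} \<in> edges H))"

definition perfect_matching :: "'a ugraph \<Rightarrow> 'a set set \<Rightarrow> bool" where
  "perfect_matching G M \<longleftrightarrow> M \<subseteq> edges G \<and> disjoint M \<and> \<Union>M = verts G"

definition has_edge_disjoint_perfect_matchings :: "'a ugraph \<Rightarrow> nat \<Rightarrow> bool" where
  "has_edge_disjoint_perfect_matchings G k \<longleftrightarrow>
     (\<exists>M :: nat \<Rightarrow> 'a set set.
        (\<forall>i<k. perfect_matching G (M i)) \<and> disjoint_family_on M {..<k})"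

end

theory Submission
  imports Defs "HOL-Analysis.Convex" "HOL-Analysis.Function_Topology"
begin

text \<open>
  Write \<open>n = 2 m\<close>. The graph has \<open>k\<close> edge-disjoint perfect matchings as soon as it has a
  \<open>k\<close>-factor, because a regular bipartite graph splits into perfect matchings, and it has a
  \<open>k\<close>-factor as soon as no cut of the associated network is smaller than \<open>k m\<close>. A smaller cut has
  one of two causes. Either some vertex has degree less than \<open>k\<close>: then a bijection of the vertices
  embeds \<open>G\<close> into the extremal graph, and \<open>\<rho>\<close> increases strictly under such a map unless it is an
  isomorphism, since the connected graph \<open>G\<close> has a positive eigenvector. Or so many edges are
  missing that \<open>G\<close> has at most \<open>m (m - 1)\<close> of them: then \<open>\<rho>(G)\<^sup>2 \<le> m (m - 1)\<close>, the squared spectral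
  radius of \<open>K\<^bsub>m-1,m\<^esub>\<close>, which the extremal graph exceeds.
\<close>

section \<open>Factors of bipartite relations\<close>

lemma card_restrict_domain:
  assumes "finite F" "finite S"
  shows "card (F \<inter> S \<times> UNIV) = (\<Sum>x\<in>S. card (F `` {x}))"
proof -
  have "F \<inter> S \<times> UNIV = Sigma S (\<lambda>x. F `` {x})" by auto
  then show ?thesis using assms by simp
qed

lemma card_restrict_range:
  assumes "finite F" "finite T"
  shows "card (F \<inter> UNIV \<times> T) = (\<Sum>y\<in>T. card (F\<inverse> `` {y}))"
proof -
  have "F \<inter> UNIV \<times> T = (F\<inverse> \<inter> T \<times> UNIV)\<inverse>" by auto
  then show ?thesis using card_restrict_domain[of "F\<inverse>" T] assms by simp
qed

definition has_degrees :: "'a set \<Rightarrow> 'b set \<Rightarrow> ('a \<Rightarrow> nat) \<Rightarrow> ('b \<Rightarrow> nat) \<Rightarrow> ('a \<times> 'b) set \<Rightarrow> bool" where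
  "has_degrees X Y a b F \<longleftrightarrow> F \<subseteq> X \<times> Y \<and>
     (\<forall>x\<in>X. card (F `` {x}) = a x) \<and> (\<forall>y\<in>Y. card (F\<inverse> `` {y}) = b y)"

abbreviation biregular :: "'a set \<Rightarrow> 'b set \<Rightarrow> nat \<Rightarrow> ('a \<times> 'b) set \<Rightarrow> bool" where
  "biregular X Y k \<equiv> has_degrees X Y (\<lambda>_. k) (\<lambda>_. k)"

text \<open>In the network with source capacities \<open>a\<close>, sink capacities \<open>b\<close> and unit capacities on \<open>F\<close>,
  no cut is smaller than the supply \<open>sum a X\<close>.\<close>

definition cut_condition :: "'a set \<Rightarrow> 'b set \<Rightarrow> ('a \<Rightarrow> nat) \<Rightarrow> ('b \<Rightarrow> nat) \<Rightarrow> ('a \<times> 'b) set \<Rightarrow> bool" where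
  "cut_condition X Y a b F \<longleftrightarrow>
     (\<forall>S T. S \<subseteq> X \<longrightarrow> T \<subseteq> Y \<longrightarrow> sum a S \<le> sum b T + card (F \<inter> S \<times> - T))"

definition tight_cut :: "'a set \<Rightarrow> 'b set \<Rightarrow> ('a \<Rightarrow> nat) \<Rightarrow> ('b \<Rightarrow> nat) \<Rightarrow> ('a \<times> 'b) set
    \<Rightarrow> 'a set \<Rightarrow> 'b set \<Rightarrow> bool" where
  "tight_cut X Y a b F S T \<longleftrightarrow>
     S \<subseteq> X \<and> T \<subseteq> Y \<and> sum a S = sum b T + card (F \<inter> S \<times> - T)"

lemma cut_conditionD:
  "cut_condition X Y a b F \<Longrightarrow> S \<subseteq> X \<Longrightarrow> T \<subseteq> Y \<Longrightarrow> sum a S \<le> sum b T + card (F \<inter> S \<times> - T)"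
  by (simp add: cut_condition_def)

lemma card_cut_submodular:
  assumes "finite F"
  shows "card (F \<inter> (S \<inter> S') \<times> - (T \<inter> T')) + card (F \<inter> (S \<union> S') \<times> - (T \<union> T'))
    \<le> card (F \<inter> S \<times> - T) + card (F \<inter> S' \<times> - T')"
proof -
  let ?P = "F \<inter> (S \<inter> S') \<times> - (T \<inter> T')" and ?Q = "F \<inter> (S \<union> S') \<times> - (T \<union> T')"
  let ?A = "F \<inter> S \<times> - T" and ?B = "F \<inter> S' \<times> - T'"
  have "card ?P + card ?Q = card (?P \<union> ?Q) + card (?P \<inter> ?Q)"
    using assms by (intro card_Un_Int) auto
  also have "\<dots> \<le> card (?A \<union> ?B) + card (?A \<inter> ?B)"
    using assms by (intro add_mono card_mono) auto
  also have "\<dots> = card ?A + card ?B"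
    using assms by (intro card_Un_Int[symmetric]) auto
  finally show ?thesis .
qed

lemma tight_cut_Int:
  assumes fin: "finite X" "finite Y" "finite F" and cut: "cut_condition X Y a b F"
    and tight: "tight_cut X Y a b F S T" "tight_cut X Y a b F S' T'"
  shows "tight_cut X Y a b F (S \<inter> S') (T \<inter> T')"
proof -
  have sub: "S \<subseteq> X" "T \<subseteq> Y" "S' \<subseteq> X" "T' \<subseteq> Y" using tight by (auto simp: tight_cut_def)
  have "finite S" "finite T" "finite S'" "finite T'"
    using sub fin by (auto intro: finite_subset)
  then have "sum a (S \<union> S') + sum a (S \<inter> S') = sum a S + sum a S'"
    and "sum b (T \<union> T') + sum b (T \<inter> T') = sum b T + sum b T'"
    by (simp_all add: sum.union_inter)
  moreover have "sum a (S \<inter> S') \<le> sum b (T \<inter> T') + card (F \<inter> (S \<inter> S') \<times> - (T \<inter> T'))"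
    and "sum a (S \<union> S') \<le> sum b (T \<union> T') + card (F \<inter> (S \<union> S') \<times> - (T \<union> T'))"
    by (rule cut_conditionD[OF cut]; use sub in blast)+
  ultimately show ?thesis
    using card_cut_submodular[OF fin(3), of S S' T T'] tight unfolding tight_cut_def by auto
qed

lemma critical_pair_tight_cut:
  assumes fin: "finite F" and cut: "cut_condition X Y a b F" and xy: "(x, y) \<in> F"
    and critical: "\<not> cut_condition X Y a b (F - {(x, y)})"
  obtains S T where "tight_cut X Y a b F S T" "x \<in> S" "y \<notin> T"
proof -
  obtain S T where ST: "S \<subseteq> X" "T \<subseteq> Y"
    and violated: "sum b T + card ((F - {(x, y)}) \<inter> S \<times> - T) < sum a S"
    using critical by (auto simp: cut_condition_def not_le)
  have satisfied: "sum a S \<le> sum b T + card (F \<inter> S \<times> - T)" using ST by (rule cut_conditionD[OF cut])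
  have remove: "(F - {(x, y)}) \<inter> S \<times> - T = F \<inter> S \<times> - T - {(x, y)}" by blast
  have crosses: "(x, y) \<in> F \<inter> S \<times> - T"
    by (rule ccontr) (use violated satisfied in \<open>simp add: remove\<close>)
  then have "card (F \<inter> S \<times> - T) = Suc (card (F \<inter> S \<times> - T - {(x, y)}))"
    using fin by (simp add: card_Suc_Diff1 del: card_Diff_insert)
  then have "tight_cut X Y a b F S T"
    using ST violated satisfied unfolding remove by (simp add: tight_cut_def)
  then show ?thesis using crosses that by blast
qed

text \<open>Uncrossing the tight cuts at \<open>x\<close> gives a tight cut \<open>(S, T)\<close> with \<open>x \<in> S\<close> that all edges at
  \<open>x\<close> cross; comparing it with \<open>(S - {x}, T)\<close> bounds the degree of \<open>x\<close>.\<close>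

lemma critical_vertex_degree_le:
  assumes fin: "finite X" "finite Y" "finite F" and cut: "cut_condition X Y a b F"
    and critical: "\<And>y. (x, y) \<in> F \<Longrightarrow> \<not> cut_condition X Y a b (F - {(x, y)})"
  shows "card (F `` {x}) \<le> a x"
proof (cases "F `` {x} = {}")
  case False
  have common: "\<exists>S T. tight_cut X Y a b F S T \<and> x \<in> S \<and> T \<inter> N = {}"
    if "finite N" "N \<noteq> {}" "N \<subseteq> F `` {x}" for N
    using that
  proof (induction N rule: finite_ne_induct)
    case (singleton y)
    then have "(x, y) \<in> F" by auto
    then show ?case using critical_pair_tight_cut[OF fin(3) cut _ critical] by blast
  next
    case (insert y N)
    then obtain S T where ST: "tight_cut X Y a b F S T" "x \<in> S" "T \<inter> N = {}" by auto
    have "(x, y) \<in> F" using insert.prems by auto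
    then obtain S' T' where ST': "tight_cut X Y a b F S' T'" "x \<in> S'" "y \<notin> T'"
      using critical_pair_tight_cut[OF fin(3) cut _ critical] by blast
    then have "x \<in> S \<inter> S'" "(T \<inter> T') \<inter> insert y N = {}" using ST by auto
    then show ?case using tight_cut_Int[OF fin cut ST(1) ST'(1)] by blast
  qed
  obtain S T where tight: "tight_cut X Y a b F S T" and ST: "x \<in> S" "T \<inter> F `` {x} = {}"
    using common[of "F `` {x}"] fin False by auto
  have sub: "S \<subseteq> X" "T \<subseteq> Y" using tight by (auto simp: tight_cut_def)
  have "F \<inter> S \<times> - T = (F \<inter> (S - {x}) \<times> - T) \<union> Pair x ` (F `` {x})" using ST by auto
  then have "card (F \<inter> S \<times> - T) = card (F \<inter> (S - {x}) \<times> - T) + card (Pair x ` (F `` {x}))"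
    using fin by (simp only:) (rule card_Un_disjoint; auto)
  then have "card (F \<inter> S \<times> - T) = card (F \<inter> (S - {x}) \<times> - T) + card (F `` {x})"
    by (simp add: card_image inj_on_def)
  moreover have "sum a (S - {x}) \<le> sum b T + card (F \<inter> (S - {x}) \<times> - T)"
    using sub by (intro cut_conditionD[OF cut]) auto
  moreover have "sum a S = a x + sum a (S - {x})"
    using sub(1) fin(1) ST(1) by (meson finite_subset sum.remove)
  ultimately show ?thesis using tight by (simp add: tight_cut_def)
qed simp

lemma cut_condition_domain_degree_ge:
  assumes cut: "cut_condition X Y a b F" and fin: "finite F" and x: "x \<in> X"
  shows "a x \<le> card (F `` {x})"
  using cut_conditionD[OF cut, of "{x}" "{}"] card_restrict_domain[OF fin, of "{x}"] x by simp

lemma cut_condition_range_degree_ge: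
  assumes cut: "cut_condition X Y a b F" and fin: "finite F" "finite Y"
    and total: "sum a X = sum b Y" and F: "F \<subseteq> X \<times> Y" and y: "y \<in> Y"
  shows "b y \<le> card (F\<inverse> `` {y})"
proof -
  have "F \<inter> X \<times> - (Y - {y}) = F \<inter> UNIV \<times> {y}" using F y by auto
  then have "sum b Y \<le> sum b (Y - {y}) + card (F\<inverse> `` {y})"
    using cut_conditionD[OF cut, of X "Y - {y}"] card_restrict_range[OF fin(1), of "{y}"] total
    by simp
  then show ?thesis using sum.remove[OF fin(2) y, of b] by simp
qed

theorem cut_condition_imp_factor:
  assumes fin: "finite X" "finite Y" and total: "sum a X = sum b Y"
    and E: "E \<subseteq> X \<times> Y" and cut: "cut_condition X Y a b E"
  obtains F where "F \<subseteq> E" "has_degrees X Y a b F"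
proof -
  have "finite E" using E fin by (meson finite_SigmaI finite_subset)
  then have "finite {F. F \<subseteq> E \<and> cut_condition X Y a b F}" by simp
  then obtain F where F: "F \<subseteq> E" "cut_condition X Y a b F"
    and minimal: "\<And>F'. F' \<subseteq> E \<Longrightarrow> cut_condition X Y a b F' \<Longrightarrow> F' \<subseteq> F \<Longrightarrow> F = F'"
    using finite_has_minimal2[of "{F. F \<subseteq> E \<and> cut_condition X Y a b F}" E] cut by auto
  have FXY: "F \<subseteq> X \<times> Y" and finF: "finite F"
    using F(1) E \<open>finite E\<close> by (auto intro: finite_subset)
  have domain: "card (F `` {x}) = a x" if "x \<in> X" for x
  proof (rule antisym)
    show "card (F `` {x}) \<le> a x"
      by (rule critical_vertex_degree_le[OF fin finF F(2)]) (use minimal F(1) in blast)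
  qed (rule cut_condition_domain_degree_ge[OF F(2) finF that])
  have "F \<inter> X \<times> UNIV = F" "F \<inter> UNIV \<times> Y = F" using FXY by auto
  then have "(\<Sum>y\<in>Y. b y) = (\<Sum>y\<in>Y. card (F\<inverse> `` {y}))"
    using card_restrict_domain[OF finF fin(1)] card_restrict_range[OF finF fin(2)] domain total
    by simp
  then have "b y = card (F\<inverse> `` {y})" if "y \<in> Y" for y
    using sum_mono_inv[of b Y "\<lambda>y. card (F\<inverse> `` {y})" y] that fin(2)
      cut_condition_range_degree_ge[OF F(2) finF fin(2) total FXY] by blast
  then show ?thesis using that F(1) FXY domain by (simp add: has_degrees_def)
qed

lemma has_degrees_Diff:
  assumes fin: "finite F" and F: "has_degrees X Y a b F" and R: "R \<subseteq> F" "has_degrees X Y c d R"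
  shows "has_degrees X Y (\<lambda>x. a x - c x) (\<lambda>y. b y - d y) (F - R)"
proof -
  have "finite R" using R(1) fin by (rule finite_subset)
  moreover have "(F - R) `` {x} = F `` {x} - R `` {x}" "R `` {x} \<subseteq> F `` {x}"
    "(F - R)\<inverse> `` {y} = F\<inverse> `` {y} - R\<inverse> `` {y}" "R\<inverse> `` {y} \<subseteq> F\<inverse> `` {y}" for x y
    using R(1) by auto
  ultimately show ?thesis using F R(2) by (auto simp: has_degrees_def card_Diff_subset)
qed

lemma biregular_imp_cut_condition_1:
  assumes fin: "finite X" "finite Y" and F: "biregular X Y k F" and k: "k > 0"
  shows "cut_condition X Y (\<lambda>_. 1) (\<lambda>_. 1) F"
  unfolding cut_condition_def
proof (intro allI impI)
  fix S T assume ST: "S \<subseteq> X" "T \<subseteq> Y"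
  have "F \<subseteq> X \<times> Y" using F by (simp add: has_degrees_def)
  then have finF: "finite F" using fin by (meson finite_SigmaI finite_subset)
  have finST: "finite S" "finite T" using ST fin by (auto intro: finite_subset)
  have cover: "F \<inter> S \<times> UNIV \<subseteq> F \<inter> UNIV \<times> T \<union> F \<inter> S \<times> - T" by auto
  have "k * card S = card (F \<inter> S \<times> UNIV)"
    using card_restrict_domain[OF finF finST(1)] F ST by (simp add: has_degrees_def subset_iff)
  also have "\<dots> \<le> card (F \<inter> UNIV \<times> T \<union> F \<inter> S \<times> - T)"
    using finF by (intro card_mono cover) auto
  also have "\<dots> \<le> card (F \<inter> UNIV \<times> T) + card (F \<inter> S \<times> - T)" by (rule card_Un_le)
  also have "card (F \<inter> UNIV \<times> T) = k * card T"
    using card_restrict_range[OF finF finST(2)] F ST by (simp add: has_degrees_def subset_iff)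
  also have "k * card T + card (F \<inter> S \<times> - T) \<le> k * (card T + card (F \<inter> S \<times> - T))"
    using k by (simp add: distrib_left)
  finally show "(\<Sum>_\<in>S. 1) \<le> (\<Sum>_\<in>T. 1) + card (F \<inter> S \<times> - T)" using k by simp
qed

lemma biregular_decomposition:
  assumes fin: "finite X" "finite Y" and cards: "card X = card Y" and F: "biregular X Y k F"
  shows "\<exists>M. (\<forall>i<k. biregular X Y 1 (M i) \<and> M i \<subseteq> F) \<and> disjoint_family_on M {..<k}"
  using F
proof (induction k arbitrary: F)
  case 0
  then show ?case by (simp add: disjoint_family_on_def)
next
  case (Suc k)
  have FXY: "F \<subseteq> X \<times> Y" using Suc.prems by (simp add: has_degrees_def)
  then have finF: "finite F" using fin by (meson finite_SigmaI finite_subset)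
  have "cut_condition X Y (\<lambda>_. 1) (\<lambda>_. 1) F"
    by (rule biregular_imp_cut_condition_1[OF fin Suc.prems]) simp
  moreover have "(\<Sum>_\<in>X. 1) = (\<Sum>_\<in>Y. 1 :: nat)" using cards by simp
  ultimately obtain R where R: "R \<subseteq> F" "biregular X Y 1 R"
    using cut_condition_imp_factor[OF fin _ FXY] by blast
  have "biregular X Y k (F - R)" using has_degrees_Diff[OF finF Suc.prems R] by simp
  then obtain M where M: "\<And>i. i < k \<Longrightarrow> biregular X Y 1 (M i) \<and> M i \<subseteq> F - R"
    and disj: "disjoint_family_on M {..<k}"
    using Suc.IH by blast
  show ?case
  proof (intro exI[of _ "M(k := R)"] conjI allI impI)
    fix i assume "i < Suc k"
    then show "biregular X Y 1 ((M(k := R)) i)" "(M(k := R)) i \<subseteq> F"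
      using M[of i] R by (auto simp: less_Suc_eq)
  next
    show "disjoint_family_on (M(k := R)) {..<Suc k}"
      using M disj unfolding disjoint_family_on_def by (auto simp: less_Suc_eq) blast+
  qed
qed

lemma card_le_of_violated_proper_cut:
  assumes fin: "finite X" "finite Y" and cards: "card X = m" "card Y = m"
    and E: "E \<subseteq> X \<times> Y" and k: "k < m" and ST: "S \<subset> X" "T \<subseteq> Y" "T \<noteq> {}"
    and violated: "k * card T + card (E \<inter> S \<times> - T) < k * card S"
  shows "card E \<le> (m - 1) * m"
proof -
  have finE: "finite E" using E fin by (meson finite_SigmaI finite_subset)
  have finST: "finite S" "finite T" using ST fin by (auto intro: finite_subset)
  define s t e where "s = int (card S)" and "t = int (card T)" and "e = int (card (E \<inter> S \<times> - T))"
  have "k * card T < k * card S" using violated by linarith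
  then have range: "t < s" "1 \<le> t" "s < int m"
    using ST finST fin(1) cards(1) psubset_card_mono[of X S]
    by (auto simp: s_def t_def Suc_le_eq card_gt_0_iff)
  have "E \<inter> S \<times> (Y - T) = E \<inter> S \<times> - T" using E by auto
  moreover have "card (E \<union> S \<times> (Y - T)) \<le> card (X \<times> Y)"
    using E ST fin by (intro card_mono) auto
  ultimately have "card E + card (S \<times> (Y - T)) \<le> m * m + card (E \<inter> S \<times> - T)"
    using card_Un_Int[of E "S \<times> (Y - T)"] finE finST fin cards by (simp add: card_cartesian_product)
  moreover have "card (S \<times> (Y - T)) = card S * (m - card T)" "card T \<le> m"
    using ST(2) finST(2) fin(2) cards(2)
    by (auto simp: card_cartesian_product card_Diff_subset intro: card_mono)
  ultimately have "int (card E) + s * (int m - t) \<le> int m * int m + e"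
    unfolding s_def t_def e_def by (metis of_nat_add of_nat_diff of_nat_le_iff of_nat_mult)
  moreover have "int k * t + e < int k * s"
    using violated unfolding s_def t_def e_def by (metis of_nat_add of_nat_less_iff of_nat_mult)
  moreover have "0 \<le> (int m - 1 - int k) * (s - t)" "0 \<le> (int m - s - 1) * (t - 1)"
    using range k by auto
  ultimately have "int (card E) \<le> (int m - 1) * int m" by (simp add: algebra_simps)
  also have "\<dots> = int ((m - 1) * m)" using k by (simp add: of_nat_diff)
  finally show ?thesis by (simp only: of_nat_le_iff)
qed

lemma cut_violation_low_degree_or_few_edges:
  assumes fin: "finite X" "finite Y" and cards: "card X = m" "card Y = m"
    and E: "E \<subseteq> X \<times> Y" and k: "k < m" and violated: "\<not> cut_condition X Y (\<lambda>_. k) (\<lambda>_. k) E"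
  shows "(\<exists>x\<in>X. card (E `` {x}) < k) \<or> (\<exists>y\<in>Y. card (E\<inverse> `` {y}) < k) \<or> card E \<le> (m - 1) * m"
proof (rule ccontr)
  assume "\<not> ?thesis"
  then have deg_X: "\<And>x. x \<in> X \<Longrightarrow> k \<le> card (E `` {x})"
    and deg_Y: "\<And>y. y \<in> Y \<Longrightarrow> k \<le> card (E\<inverse> `` {y})"
    and many: "\<not> card E \<le> (m - 1) * m" by (auto simp: not_less)
  have finE: "finite E" using E fin by (meson finite_SigmaI finite_subset)
  obtain S T where ST: "S \<subseteq> X" "T \<subseteq> Y" and small_cut: "k * card T + card (E \<inter> S \<times> - T) < k * card S"
    using violated by (auto simp: cut_condition_def not_le mult.commute)
  then have finST: "finite S" "finite T" using fin by (auto intro: finite_subset)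
  have "T \<noteq> {}"
  proof
    assume "T = {}"
    moreover have "(\<Sum>x\<in>S. k) \<le> card (E \<inter> S \<times> UNIV)"
      unfolding card_restrict_domain[OF finE finST(1)] by (rule sum_mono) (use deg_X ST in blast)
    ultimately show False using small_cut by (simp add: mult.commute)
  qed
  moreover have "S \<noteq> X"
  proof
    assume "S = X"
    have "(\<Sum>y\<in>Y - T. k) \<le> card (E \<inter> UNIV \<times> (Y - T))"
      unfolding card_restrict_range[OF finE finite_Diff[OF fin(2)]]
      by (rule sum_mono) (use deg_Y in blast)
    also have "E \<inter> UNIV \<times> (Y - T) = E \<inter> S \<times> - T" using E \<open>S = X\<close> by auto
    finally have "k * card T + k * card (Y - T) < k * m"
      using small_cut \<open>S = X\<close> cards by (simp add: mult.commute)
    moreover have "card T + card (Y - T) = m"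
      using finST(2) ST(2) card_mono[OF fin(2) ST(2)] cards(2) by (simp add: card_Diff_subset)
    ultimately show False by (simp flip: distrib_left)
  qed
  ultimately show False
    using card_le_of_violated_proper_cut[OF fin cards E k _ ST(2) _ small_cut] ST(1) many by blast
qed

section \<open>The Rayleigh principle\<close>

definition quadratic_form :: "'a set \<Rightarrow> ('a \<Rightarrow> 'a \<Rightarrow> real) \<Rightarrow> ('a \<Rightarrow> real) \<Rightarrow> real" where
  "quadratic_form V a f = (\<Sum>u\<in>V. \<Sum>v\<in>V. a u v * f u * f v)"

definition eigenfunction :: "'a set \<Rightarrow> ('a \<Rightarrow> 'a \<Rightarrow> real) \<Rightarrow> real \<Rightarrow> ('a \<Rightarrow> real) \<Rightarrow> bool" where
  "eigenfunction V a \<mu> f \<longleftrightarrow>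
     (\<exists>u\<in>V. f u \<noteq> 0) \<and> (\<forall>u\<in>V. (\<Sum>v\<in>V. a u v * f v) = \<mu> * f u)"

abbreviation sum_squares :: "'a set \<Rightarrow> ('a \<Rightarrow> real) \<Rightarrow> real" where
  "sum_squares V f \<equiv> \<Sum>u\<in>V. (f u)\<^sup>2"

lemma sum_squares_pos_iff:
  assumes "finite V"
  shows "0 < sum_squares V f \<longleftrightarrow> (\<exists>u\<in>V. f u \<noteq> 0)"
  using sum_nonneg_eq_0_iff[OF assms, of "\<lambda>u. (f u)\<^sup>2"] sum_nonneg[of V "\<lambda>u. (f u)\<^sup>2"]
  by (auto simp: less_le)

lemma quadratic_form_eigenfunction:
  assumes "eigenfunction V a \<mu> f"
  shows "quadratic_form V a f = \<mu> * sum_squares V f"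
proof -
  have "quadratic_form V a f = (\<Sum>u\<in>V. f u * (\<Sum>v\<in>V. a u v * f v))"
    by (simp add: quadratic_form_def sum_distrib_left mult_ac)
  also have "\<dots> = (\<Sum>u\<in>V. f u * (\<mu> * f u))"
    using assms by (simp add: eigenfunction_def)
  finally show ?thesis by (simp add: sum_distrib_left power2_eq_square mult_ac)
qed

lemma quadratic_form_scale: "quadratic_form V a (\<lambda>u. c * f u) = c\<^sup>2 * quadratic_form V a f"
  by (simp add: quadratic_form_def sum_distrib_left power2_eq_square mult_ac)

lemma quadratic_form_add_scaled:
  assumes sym: "\<And>u v. u \<in> V \<Longrightarrow> v \<in> V \<Longrightarrow> a u v = a v u"
  shows "quadratic_form V a (\<lambda>u. f u + t * g u) =
    quadratic_form V a f + 2 * t * (\<Sum>u\<in>V. g u * (\<Sum>v\<in>V. a u v * f v)) + t\<^sup>2 * quadratic_form V a g"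
proof -
  have "(\<Sum>u\<in>V. \<Sum>v\<in>V. a u v * f u * g v) = (\<Sum>v\<in>V. \<Sum>u\<in>V. a u v * f u * g v)"
    by (rule sum.swap)
  also have "\<dots> = (\<Sum>u\<in>V. g u * (\<Sum>v\<in>V. a u v * f v))"
    unfolding sum_distrib_left by (intro sum.cong refl) (simp add: sym mult_ac)
  finally have "(\<Sum>u\<in>V. \<Sum>v\<in>V. a u v * f u * g v) = (\<Sum>u\<in>V. g u * (\<Sum>v\<in>V. a u v * f v))" .
  moreover have "(\<Sum>u\<in>V. \<Sum>v\<in>V. a u v * g u * f v) = (\<Sum>u\<in>V. g u * (\<Sum>v\<in>V. a u v * f v))"
    by (simp add: sum_distrib_left mult_ac)
  moreover have "quadratic_form V a (\<lambda>u. f u + t * g u) = quadratic_form V a f +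
      t * (\<Sum>u\<in>V. \<Sum>v\<in>V. a u v * f u * g v) + t * (\<Sum>u\<in>V. \<Sum>v\<in>V. a u v * g u * f v) +
      t\<^sup>2 * quadratic_form V a g"
    by (simp add: quadratic_form_def sum_distrib_left sum.distrib algebra_simps power2_eq_square)
  ultimately show ?thesis by simp
qed

lemma quadratic_form_maximizer_eigenfunction:
  assumes fin: "finite V" and sym: "\<And>u v. u \<in> V \<Longrightarrow> v \<in> V \<Longrightarrow> a u v = a v u"
    and nonzero: "\<exists>u\<in>V. f u \<noteq> 0"
    and attained: "quadratic_form V a f = \<mu> * sum_squares V f"
    and bounded: "\<And>g. quadratic_form V a g \<le> \<mu> * sum_squares V g"
  shows "eigenfunction V a \<mu> f"
proof -
  define g where "g u = (\<Sum>v\<in>V. a u v * f v) - \<mu> * f u" for u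
  define N where "N = sum_squares V g"
  define K where "K = \<mu> * N - quadratic_form V a g"
  have variation: "2 * t * N \<le> t\<^sup>2 * K" for t
  proof -
    have "(\<Sum>u\<in>V. (f u + t * g u)\<^sup>2) = sum_squares V f + 2 * t * (\<Sum>u\<in>V. g u * f u) + t\<^sup>2 * N"
      by (simp add: N_def power2_sum sum.distrib sum_distrib_left power_mult_distrib mult_ac)
    moreover have "(\<Sum>u\<in>V. g u * (\<Sum>v\<in>V. a u v * f v)) = N + \<mu> * (\<Sum>u\<in>V. g u * f u)"
    proof -
      have "(\<Sum>u\<in>V. g u * (\<Sum>v\<in>V. a u v * f v)) = (\<Sum>u\<in>V. g u * (g u + \<mu> * f u))"
        by (simp add: g_def)
      then show ?thesis
        by (simp add: N_def distrib_left sum.distrib sum_distrib_left power2_eq_square mult_ac)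
    qed
    ultimately show ?thesis
      using bounded[of "\<lambda>u. f u + t * g u"] attained quadratic_form_add_scaled[of V a f t g, OF sym]
      by (simp add: K_def algebra_simps)
  qed
  have "N = 0"
  proof (rule ccontr)
    assume "N \<noteq> 0"
    moreover have "N \<ge> 0" unfolding N_def by (rule sum_nonneg) simp
    ultimately have N: "N > 0" by simp
    define t where "t = N / (\<bar>K\<bar> + 1)"
    have "t > 0" using N by (simp add: t_def)
    then have "2 * N \<le> t * K" using variation[of t] by (simp add: power2_eq_square)
    also have "\<dots> \<le> t * (\<bar>K\<bar> + 1)" using \<open>t > 0\<close> by (intro mult_left_mono) auto
    also have "\<dots> = N" by (simp add: t_def)
    finally show False using N by simp
  qed
  then have "\<forall>u\<in>V. g u = 0" using fin by (simp add: N_def sum_nonneg_eq_0_iff)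
  then show ?thesis using nonzero by (simp add: eigenfunction_def g_def)
qed

lemma continuous_on_quadratic_form: "continuous_on S (quadratic_form V a)"
proof -
  have "continuous_on UNIV (\<lambda>f. \<Sum>u\<in>V. \<Sum>v\<in>V. a u v * f u * f v)"
    by (intro continuous_on_sum continuous_on_mult continuous_on_const) simp_all
  then show ?thesis
    unfolding quadratic_form_def[abs_def] by (rule continuous_on_subset) simp
qed

lemma quadratic_form_attains_max_on_sphere:
  fixes V :: "'a set"
  assumes fin: "finite V" and ne: "V \<noteq> {}"
  shows "\<exists>f. sum_squares V f = 1 \<and>
    (\<forall>g. sum_squares V g = 1 \<longrightarrow> quadratic_form V a g \<le> quadratic_form V a f)"
proof -
  define box where "box u = (if u \<in> V then {-1..1} else {0 :: real})" for u
  define S where "S = {f. sum_squares V f = 1} \<inter> PiE UNIV box"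
  have mem_S: "f \<in> S \<longleftrightarrow> sum_squares V f = 1 \<and> (\<forall>u. f u \<in> box u)" for f
    by (auto simp: S_def)
  have "compact (box u)" for u by (simp add: box_def)
  then have "compact (PiE UNIV box)"
    using compactin_PiE[of "\<lambda>_. euclidean" UNIV box] by (simp add: euclidean_product_topology)
  moreover have "closed {f :: 'a \<Rightarrow> real. sum_squares V f = 1}"
    by (intro closed_Collect_eq continuous_on_sum continuous_on_power continuous_on_const) simp
  ultimately have "compact S" unfolding S_def by (rule closed_Int_compact[rotated])
  moreover have "S \<noteq> {}"
  proof -
    obtain u where "u \<in> V" using ne by blast
    then have "(\<lambda>v. if v = u then 1 else 0) \<in> S"
      using fin by (auto simp: mem_S box_def if_distrib[of "\<lambda>x. x\<^sup>2"] cong: if_cong)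
    then show ?thesis by blast
  qed
  moreover have "continuous_on S (quadratic_form V a)" by (rule continuous_on_quadratic_form)
  ultimately have "\<exists>f\<in>S. \<forall>g\<in>S. quadratic_form V a g \<le> quadratic_form V a f"
    by (rule continuous_attains_sup)
  then obtain f where f: "f \<in> S" and max: "\<forall>g\<in>S. quadratic_form V a g \<le> quadratic_form V a f"
    by (rule bexE)
  have "quadratic_form V a g \<le> quadratic_form V a f" if g: "sum_squares V g = 1" for g
  proof -
    let ?g = "\<lambda>u. if u \<in> V then g u else 0"
    have "(g u)\<^sup>2 \<le> 1" if "u \<in> V" for u
      using member_le_sum[OF that, of "\<lambda>u. (g u)\<^sup>2"] fin g by simp
    then have "?g \<in> S" using g by (auto simp: mem_S box_def abs_square_le_1 abs_le_iff)
    from bspec[OF max this] show ?thesis by (simp add: quadratic_form_def)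
  qed
  then show ?thesis using f by (intro exI[of _ f]) (simp add: mem_S)
qed

theorem Rayleigh_principle:
  assumes fin: "finite V" and ne: "V \<noteq> {}"
    and sym: "\<And>u v. u \<in> V \<Longrightarrow> v \<in> V \<Longrightarrow> a u v = a v u"
  shows "\<exists>\<mu> f. eigenfunction V a \<mu> f \<and>
    (\<forall>g. quadratic_form V a g \<le> \<mu> * sum_squares V g)"
proof -
  obtain f where f: "sum_squares V f = 1"
    and max: "\<forall>g. sum_squares V g = 1 \<longrightarrow> quadratic_form V a g \<le> quadratic_form V a f"
    using quadratic_form_attains_max_on_sphere[OF fin ne, of a] by blast
  define \<mu> where "\<mu> = quadratic_form V a f"
  have bounded: "quadratic_form V a g \<le> \<mu> * sum_squares V g" for g
  proof (cases "\<exists>u\<in>V. g u \<noteq> 0")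
    case True
    define r where "r = sqrt (sum_squares V g)"
    have r: "r > 0" "r\<^sup>2 = sum_squares V g"
      using True fin by (auto simp: r_def sum_squares_pos_iff sum_nonneg)
    then have "(\<Sum>u\<in>V. (inverse r * g u)\<^sup>2) = 1"
      unfolding power_mult_distrib sum_distrib_left[symmetric] r(2)[symmetric]
      using r(1) by (simp add: power_inverse)
    from max[rule_format, OF this] show ?thesis
      using r(1) unfolding quadratic_form_scale \<mu>_def r(2)[symmetric]
      by (simp add: power_inverse field_simps)
  qed (simp add: quadratic_form_def)
  have "eigenfunction V a \<mu> f"
  proof (rule quadratic_form_maximizer_eigenfunction[OF fin sym _ _ bounded])
    show "\<exists>u\<in>V. f u \<noteq> 0" using f sum_squares_pos_iff[OF fin, of f] by simp
    show "quadratic_form V a f = \<mu> * sum_squares V f" by (simp add: f \<mu>_def)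
  qed
  then show ?thesis using bounded by blast
qed

lemma eigenvalue_mat_iff_eigenfunction:
  assumes e: "bij_betw e {..<n} V"
  shows "eigenvalue (mat n n (\<lambda>(i, j). a (e i) (e j))) \<mu> \<longleftrightarrow> (\<exists>f. eigenfunction V a \<mu> f)"
    (is "eigenvalue ?A \<mu> \<longleftrightarrow> _")
proof -
  have mult: "(?A *\<^sub>v vec n (\<lambda>i. f (e i))) $ i = (\<Sum>v\<in>V. a (e i) v * f v)" if "i < n" for f i
    using that sum.reindex_bij_betw[OF e, of "\<lambda>v. a (e i) v * f v"]
    by (simp add: scalar_prod_def lessThan_atLeast0)
  have "eigenvector ?A (vec n (\<lambda>i. f (e i))) \<mu> \<longleftrightarrow> eigenfunction V a \<mu> f" for f
  proof -
    have "eigenvector ?A (vec n (\<lambda>i. f (e i))) \<mu> \<longleftrightarrow>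
        (\<exists>i<n. f (e i) \<noteq> 0) \<and> (\<forall>i<n. (\<Sum>v\<in>V. a (e i) v * f v) = \<mu> * f (e i))"
      by (auto simp: eigenvector_def vec_eq_iff mult simp del: index_mult_mat_vec)
    also have "\<dots> \<longleftrightarrow> eigenfunction V a \<mu> f"
      unfolding eigenfunction_def bij_betw_imp_surj_on[OF e, symmetric] by auto
    finally show ?thesis .
  qed
  moreover have "\<exists>f. v = vec n (\<lambda>i. f (e i))" if "v \<in> carrier_vec n" for v :: "real vec"
    using that bij_betw_inv_into_left[OF e]
    by (intro exI[of _ "\<lambda>u. v $ inv_into {..<n} e u"] eq_vecI) auto
  ultimately show ?thesis
    unfolding eigenvalue_def by (metis eigenvector_def dim_row_mat(1))
qed

section \<open>Spectral radii of graphs\<close>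

definition adjacency :: "'a ugraph \<Rightarrow> 'a \<Rightarrow> 'a \<Rightarrow> real" where
  "adjacency G u v = of_bool ({u, v} \<in> edges G)"

abbreviation adjacency_form :: "'a ugraph \<Rightarrow> ('a \<Rightarrow> real) \<Rightarrow> real" where
  "adjacency_form G \<equiv> quadratic_form (verts G) (adjacency G)"

abbreviation graph_eigenfunction :: "'a ugraph \<Rightarrow> real \<Rightarrow> ('a \<Rightarrow> real) \<Rightarrow> bool" where
  "graph_eigenfunction G \<equiv> eigenfunction (verts G) (adjacency G)"

lemma adjacency_sym: "adjacency G u v = adjacency G v u"
  by (simp add: adjacency_def insert_commute)

lemma spectrum_adjacency_matrix:
  assumes "finite (verts G)"
  shows "spectrum (adjacency_matrix G) = {\<mu>. \<exists>f. graph_eigenfunction G \<mu> f}"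
proof -
  have bij: "bij_betw (vertex_enum G) {..<card (verts G)} (verts G)"
    unfolding vertex_enum_def lessThan_atLeast0
    using ex_bij_betw_nat_finite[OF assms] by (rule someI_ex)
  have mat: "adjacency_matrix G = mat (card (verts G)) (card (verts G))
      (\<lambda>(i, j). adjacency G (vertex_enum G i) (vertex_enum G j))"
    by (simp add: adjacency_matrix_def adjacency_def of_bool_def)
  show ?thesis
    unfolding spectrum_def mat
    by (intro Collect_cong eigenvalue_mat_iff_eigenfunction[OF bij])
qed

theorem graph_spectral_radius_Rayleigh:
  assumes fin: "finite (verts G)" and ne: "verts G \<noteq> {}"
  shows "\<exists>f. graph_eigenfunction G (graph_spectral_radius G) f"
    and "adjacency_form G g \<le> graph_spectral_radius G * sum_squares (verts G) g"
proof -
  obtain \<mu> f where f: "graph_eigenfunction G \<mu> f"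
    and bounded: "\<forall>g. adjacency_form G g \<le> \<mu> * sum_squares (verts G) g"
    using Rayleigh_principle[of "verts G" "adjacency G", OF fin ne adjacency_sym] by blast
  have "finite (spectrum (adjacency_matrix G))"
    using card_finite_spectrum[of "adjacency_matrix G" "card (verts G)"]
    by (simp add: adjacency_matrix_def)
  moreover have "\<nu> \<le> \<mu>" if \<nu>: "\<nu> \<in> spectrum (adjacency_matrix G)" for \<nu>
  proof -
    obtain h where h: "graph_eigenfunction G \<nu> h"
      using \<nu> by (auto simp: spectrum_adjacency_matrix[OF fin])
    then have "0 < sum_squares (verts G) h"
      using fin by (simp add: sum_squares_pos_iff eigenfunction_def)
    then show ?thesis using bounded[rule_format, of h] quadratic_form_eigenfunction[OF h] by simp
  qed
  ultimately have "graph_spectral_radius G = \<mu>"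
    unfolding graph_spectral_radius_def
    using f spectrum_adjacency_matrix[OF fin] by (intro Max_eqI) auto
  then show "\<exists>f. graph_eigenfunction G (graph_spectral_radius G) f"
    and "adjacency_form G g \<le> graph_spectral_radius G * sum_squares (verts G) g"
    using f bounded by auto
qed

lemma nonneg_eigenfunction_pos:
  assumes sg: "simple_graph G" and conn: "connected_graph G"
    and f: "graph_eigenfunction G \<mu> f" and nonneg: "\<And>u. u \<in> verts G \<Longrightarrow> 0 \<le> f u"
    and w: "w \<in> verts G"
  shows "0 < f w"
proof (rule ccontr)
  assume "\<not> 0 < f w"
  then have w0: "f w = 0" using nonneg[OF w] by simp
  have fin: "finite (verts G)" using sg by (simp add: simple_graph_def)
  have zero_spreads: "v \<in> verts G \<and> f v = 0"
    if u: "u \<in> verts G" "f u = 0" and uv: "{u, v} \<in> edges G" for u v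
  proof -
    have v: "v \<in> verts G" using sg uv by (auto simp: simple_graph_def)
    have "(\<Sum>v\<in>verts G. adjacency G u v * f v) = 0" using f u by (simp add: eigenfunction_def)
    then have "adjacency G u v * f v = 0"
      using sum_nonneg_0[OF fin, of "\<lambda>v. adjacency G u v * f v" v] nonneg v
      by (simp add: adjacency_def)
    then show ?thesis using v uv by (simp add: adjacency_def)
  qed
  have "f u = 0" if "u \<in> verts G" for u
  proof -
    have "(w, u) \<in> {(x, y). {x, y} \<in> edges G}\<^sup>*"
      using conn w that by (simp add: connected_graph_def)
    then have "u \<in> verts G \<and> f u = 0"
    proof (induction rule: rtrancl_induct)
      case base
      show ?case using w w0 by simp
    next
      case (step u v)
      then show ?case using zero_spreads by blast
    qed
    then show ?thesis by simp
  qed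
  then show False using f by (auto simp: eigenfunction_def)
qed

theorem connected_graph_Perron_eigenfunction:
  assumes sg: "simple_graph G" and conn: "connected_graph G"
  shows "\<exists>f. graph_eigenfunction G (graph_spectral_radius G) f \<and>
    (\<forall>u\<in>verts G. 0 < f u)"
proof -
  let ?V = "verts G" and ?\<rho> = "graph_spectral_radius G"
  have fin: "finite ?V" and ne: "?V \<noteq> {}"
    using sg conn by (auto simp: simple_graph_def connected_graph_def)
  obtain f where f: "graph_eigenfunction G ?\<rho> f"
    using graph_spectral_radius_Rayleigh(1)[OF fin ne] by blast
  let ?g = "\<lambda>u. \<bar>f u\<bar>"
  have "?\<rho> * sum_squares ?V ?g = adjacency_form G f"
    using quadratic_form_eigenfunction[OF f] by simp
  also have "\<dots> \<le> adjacency_form G ?g"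
    unfolding quadratic_form_def
  proof (intro sum_mono)
    fix u v
    show "adjacency G u v * f u * f v \<le> adjacency G u v * \<bar>f u\<bar> * \<bar>f v\<bar>"
      using abs_ge_self[of "f u * f v"] by (simp add: adjacency_def abs_mult)
  qed
  finally have attained: "adjacency_form G ?g = ?\<rho> * sum_squares ?V ?g"
    using graph_spectral_radius_Rayleigh(2)[OF fin ne, of ?g] by simp
  have g: "graph_eigenfunction G ?\<rho> ?g"
  proof (rule quadratic_form_maximizer_eigenfunction[OF fin adjacency_sym _ attained])
    show "\<exists>u\<in>?V. ?g u \<noteq> 0" using f by (simp add: eigenfunction_def)
  qed (rule graph_spectral_radius_Rayleigh(2)[OF fin ne])
  then have "0 < ?g u" if "u \<in> ?V" for u
    by (rule nonneg_eigenfunction_pos[OF sg conn _ _ that]) simp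
  with g show ?thesis by (intro exI[of _ ?g]) simp
qed

theorem spectral_radius_less_of_bijective_hom:
  assumes sg: "simple_graph G" and conn: "connected_graph G"
    and bij: "bij_betw \<phi> (verts G) (verts H)"
    and hom: "\<And>u v. u \<in> verts G \<Longrightarrow> v \<in> verts G \<Longrightarrow> {u, v} \<in> edges G \<Longrightarrow> {\<phi> u, \<phi> v} \<in> edges H"
    and not_iso: "\<not> graph_isomorphic G H"
  shows "graph_spectral_radius G < graph_spectral_radius H"
proof -
  let ?V = "verts G"
  have fin: "finite ?V" and ne: "?V \<noteq> {}"
    using sg conn by (auto simp: simple_graph_def connected_graph_def)
  obtain f where f: "graph_eigenfunction G (graph_spectral_radius G) f"
    and pos: "\<And>u. u \<in> ?V \<Longrightarrow> 0 < f u"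
    using connected_graph_Perron_eigenfunction[OF sg conn] by blast
  define N where "N = sum_squares ?V f"
  define h where "h = f \<circ> inv_into ?V \<phi>"
  have h: "h (\<phi> u) = f u" if "u \<in> ?V" for u
    using that bij by (simp add: h_def bij_betw_inv_into_left)
  have entry_le: "adjacency G u v * f u * f v \<le> adjacency H (\<phi> u) (\<phi> v) * f u * f v"
    if "u \<in> ?V" "v \<in> ?V" for u v
    using that hom pos by (auto simp: adjacency_def less_imp_le)
  obtain u v where uv: "u \<in> ?V" "v \<in> ?V" and new: "{u, v} \<notin> edges G" "{\<phi> u, \<phi> v} \<in> edges H"
    using not_iso bij hom unfolding graph_isomorphic_def by blast
  then have "adjacency G u v * f u * f v < adjacency H (\<phi> u) (\<phi> v) * f u * f v"
    using pos by (simp add: adjacency_def)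
  then have "(\<Sum>v\<in>?V. adjacency G u v * f u * f v) < (\<Sum>v\<in>?V. adjacency H (\<phi> u) (\<phi> v) * f u * f v)"
    using fin uv entry_le by (intro sum_strict_mono_ex1) auto
  then have "adjacency_form G f < (\<Sum>u\<in>?V. \<Sum>v\<in>?V. adjacency H (\<phi> u) (\<phi> v) * f u * f v)"
    unfolding quadratic_form_def
    using fin uv entry_le by (intro sum_strict_mono_ex1) (auto intro!: sum_mono)
  also have "\<dots> = adjacency_form H h"
    unfolding quadratic_form_def by (simp add: h flip: sum.reindex_bij_betw[OF bij])
  also have "\<dots> \<le> graph_spectral_radius H * sum_squares (verts H) h"
    using bij fin ne bij_betw_finite[OF bij] bij_betw_empty2[of \<phi> ?V]
    by (intro graph_spectral_radius_Rayleigh(2)) auto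
  also have "sum_squares (verts H) h = N"
    unfolding N_def by (simp add: h flip: sum.reindex_bij_betw[OF bij])
  finally have "graph_spectral_radius G * N < graph_spectral_radius H * N"
    using quadratic_form_eigenfunction[OF f] by (simp add: N_def)
  moreover have "0 \<le> N" unfolding N_def by (rule sum_nonneg) simp
  ultimately show ?thesis using mult_less_cancel_right by fastforce
qed

section \<open>Bipartite graphs\<close>

definition bip_rel :: "'a ugraph \<Rightarrow> 'a set \<Rightarrow> 'a set \<Rightarrow> ('a \<times> 'a) set" where
  "bip_rel G X Y = {(x, y). x \<in> X \<and> y \<in> Y \<and> {x, y} \<in> edges G}"

lemma bip_rel_subset: "bip_rel G X Y \<subseteq> X \<times> Y"
  by (auto simp: bip_rel_def)

lemma converse_bip_rel: "(bip_rel G X Y)\<inverse> = bip_rel G Y X"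
  by (auto simp: bip_rel_def insert_commute)

lemma bipartition_sym: "bipartition G X Y \<Longrightarrow> bipartition G Y X"
  unfolding bipartition_def by (metis Int_commute Un_commute insert_commute)

lemma bipartition_hom:
  assumes bip: "bipartition G X Y" and uv: "{u, v} \<in> edges G"
    and hom: "\<And>x y. x \<in> X \<Longrightarrow> y \<in> Y \<Longrightarrow> {x, y} \<in> edges G \<Longrightarrow> {\<phi> x, \<phi> y} \<in> edges H"
  shows "{\<phi> u, \<phi> v} \<in> edges H"
proof -
  have "\<exists>x\<in>X. \<exists>y\<in>Y. {u, v} = {x, y}" using bip uv by (simp add: bipartition_def)
  then obtain x y where xy: "x \<in> X" "y \<in> Y" "{u, v} = {x, y}" by (elim bexE)
  have "{\<phi> u, \<phi> v} = \<phi> ` {u, v}" by simp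
  also have "\<dots> = {\<phi> x, \<phi> y}" unfolding xy(3) by simp
  finally show ?thesis using hom[OF xy(1,2)] uv unfolding xy(3) by simp
qed

lemma biregular_1_ex1:
  assumes R: "biregular X Y 1 R"
  shows "x \<in> X \<Longrightarrow> \<exists>!y. (x, y) \<in> R" and "y \<in> Y \<Longrightarrow> \<exists>!x. (x, y) \<in> R"
proof -
  show "\<exists>!y. (x, y) \<in> R" if x: "x \<in> X"
  proof -
    obtain y where "R `` {x} = {y}" using R x by (auto simp: has_degrees_def card_1_singleton_iff)
    then show ?thesis by (intro ex1I[of _ y]) blast+
  qed
  show "\<exists>!x. (x, y) \<in> R" if y: "y \<in> Y"
  proof -
    obtain x where "R\<inverse> `` {y} = {x}" using R y by (auto simp: has_degrees_def card_1_singleton_iff)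
    then show ?thesis by (intro ex1I[of _ x]) blast+
  qed
qed

lemma perfect_matching_of_biregular:
  assumes bip: "bipartition G X Y" and R: "biregular X Y 1 R" "R \<subseteq> bip_rel G X Y"
  shows "perfect_matching G ((\<lambda>(x, y). {x, y}) ` R)" (is "perfect_matching G ?M")
  unfolding perfect_matching_def
proof (intro conjI)
  have parts: "verts G = X \<union> Y" "X \<inter> Y = {}" using bip by (auto simp: bipartition_def)
  have RXY: "R \<subseteq> X \<times> Y" using R(1) by (simp add: has_degrees_def)
  show "?M \<subseteq> edges G" using R(2) by (auto simp: bip_rel_def)
  show "disjoint ?M"
  proof (rule disjointI)
    fix e e' assume e: "e \<in> ?M" "e' \<in> ?M" "e \<noteq> e'"
    then obtain x y x' y' where xy: "e = {x, y}" "(x, y) \<in> R" "e' = {x', y'}" "(x', y') \<in> R" by auto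
    then have mem: "x \<in> X" "y \<in> Y" "x' \<in> X" "y' \<in> Y" using RXY by auto
    then have "x \<noteq> y'" "y \<noteq> x'" using parts(2) by auto
    moreover have "x \<noteq> x'" using biregular_1_ex1(1)[OF R(1) mem(1)] xy e(3) by blast
    moreover have "y \<noteq> y'" using biregular_1_ex1(2)[OF R(1) mem(2)] xy e(3) by blast
    ultimately show "e \<inter> e' = {}" using xy by auto
  qed
  show "\<Union> ?M = verts G"
  proof
    show "\<Union> ?M \<subseteq> verts G" using RXY parts(1) by auto
    have "\<exists>e\<in>R. v = fst e \<or> v = snd e" if "v \<in> verts G" for v
      using that parts(1) biregular_1_ex1[OF R(1), of v] by force
    then show "verts G \<subseteq> \<Union> ?M" by fastforce
  qed
qed

lemma cut_condition_imp_edge_disjoint_perfect_matchings: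
  assumes fin: "finite X" "finite Y" and cards: "card X = card Y"
    and bip: "bipartition G X Y" and cut: "cut_condition X Y (\<lambda>_. k) (\<lambda>_. k) (bip_rel G X Y)"
  shows "has_edge_disjoint_perfect_matchings G k"
proof -
  let ?edge = "\<lambda>(x, y). {x, y}"
  have "(\<Sum>_\<in>X. k) = (\<Sum>_\<in>Y. k)" using cards by simp
  then obtain F where F: "F \<subseteq> bip_rel G X Y" "biregular X Y k F"
    using cut_condition_imp_factor[OF fin _ bip_rel_subset cut] by blast
  obtain M where M: "\<And>i. i < k \<Longrightarrow> biregular X Y 1 (M i) \<and> M i \<subseteq> F"
    and disj: "disjoint_family_on M {..<k}"
    using biregular_decomposition[OF fin cards F(2)] by blast
  have "X \<inter> Y = {}" using bip by (simp add: bipartition_def)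
  then have inj: "inj_on ?edge (X \<times> Y)" by (fastforce simp: inj_on_def doubleton_eq_iff)
  have "disjoint_family_on (\<lambda>i. ?edge ` M i) {..<k}"
    unfolding disjoint_family_on_def
  proof (intro ballI impI)
    fix i j assume ij: "i \<in> {..<k}" "j \<in> {..<k}" "i \<noteq> j"
    then have "M i \<subseteq> X \<times> Y" "M j \<subseteq> X \<times> Y" "M i \<inter> M j = {}"
      using M disj by (auto simp: has_degrees_def disjoint_family_on_def)
    then show "?edge ` M i \<inter> ?edge ` M j = {}"
      using inj_on_image_Int[OF inj, of "M i" "M j"] by simp
  qed
  moreover have "perfect_matching G (?edge ` M i)" if "i < k" for i
    using M[OF that] F(1) perfect_matching_of_biregular[OF bip] by blast
  ultimately show ?thesis
    unfolding has_edge_disjoint_perfect_matchings_def by (intro exI[of _ "\<lambda>i. ?edge ` M i"]) simp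
qed

lemma adjacency_form_bipartite:
  assumes fin: "finite X" "finite Y" and bip: "bipartition G X Y"
  shows "adjacency_form G f = 2 * (\<Sum>(x, y)\<in>bip_rel G X Y. f x * f y)"
proof -
  have parts: "verts G = X \<union> Y" "X \<inter> Y = {}"
    and edge: "\<And>u v. {u, v} \<in> edges G \<Longrightarrow> u \<in> X \<and> v \<in> Y \<or> u \<in> Y \<and> v \<in> X"
    using bip by (auto simp: bipartition_def doubleton_eq_iff dest!: bspec)
  have no_edge: "adjacency G u v = 0" if "u \<in> X \<and> v \<in> X \<or> u \<in> Y \<and> v \<in> Y" for u v
    using edge[of u v] parts(2) that by (auto simp: adjacency_def)
  have "(\<Sum>y\<in>Y. \<Sum>x\<in>X. adjacency G y x * f y * f x) = (\<Sum>x\<in>X. \<Sum>y\<in>Y. adjacency G x y * f x * f y)"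
    by (subst sum.swap) (simp add: adjacency_sym mult_ac)
  then have "adjacency_form G f = 2 * (\<Sum>x\<in>X. \<Sum>y\<in>Y. adjacency G x y * f x * f y)"
    unfolding quadratic_form_def parts(1)
    by (simp add: sum.union_disjoint[OF fin parts(2)] sum.distrib no_edge)
  also have "(\<Sum>x\<in>X. \<Sum>y\<in>Y. adjacency G x y * f x * f y) =
      (\<Sum>(x, y)\<in>X \<times> Y. if {x, y} \<in> edges G then f x * f y else 0)"
    unfolding sum.cartesian_product by (intro sum.cong) (auto simp: adjacency_def)
  also have "\<dots> = (\<Sum>(x, y)\<in>bip_rel G X Y. f x * f y)"
    using fin by (intro sum.mono_neutral_cong_right) (auto simp: bip_rel_def split: if_splits)
  finally show ?thesis .
qed

lemma bipartite_eigenvalue_square_le_card_edges: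
  assumes fin: "finite X" "finite Y" and bip: "bipartition G X Y"
    and f: "graph_eigenfunction G \<mu> f"
  shows "\<mu>\<^sup>2 \<le> real (card (bip_rel G X Y))"
proof -
  let ?E = "bip_rel G X Y" and ?a = "sum_squares X f" and ?b = "sum_squares Y f"
  define P where "P = (\<Sum>(x, y)\<in>?E. f x * f y)"
  have parts: "verts G = X \<union> Y" "X \<inter> Y = {}" using bip by (auto simp: bipartition_def)
  have norm: "sum_squares (verts G) f = ?a + ?b" using parts fin by (simp add: sum.union_disjoint)
  then have "\<mu> * (?a + ?b) = 2 * P"
    using quadratic_form_eigenfunction[OF f] adjacency_form_bipartite[OF fin bip]
    by (simp add: P_def)
  have "P\<^sup>2 = (\<Sum>e\<in>?E. 1 * (case e of (x, y) \<Rightarrow> f x * f y))\<^sup>2" by (simp add: P_def)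
  also have "\<dots> \<le> (\<Sum>e\<in>?E. 1\<^sup>2) * (\<Sum>e\<in>?E. (case e of (x, y) \<Rightarrow> f x * f y)\<^sup>2)"
    by (rule Cauchy_Schwarz_ineq_sum)
  also have "\<dots> \<le> real (card ?E) * (\<Sum>e\<in>X \<times> Y. (case e of (x, y) \<Rightarrow> f x * f y)\<^sup>2)"
    using fin bip_rel_subset by (simp, intro mult_left_mono sum_mono2) auto
  also have "(\<Sum>e\<in>X \<times> Y. (case e of (x, y) \<Rightarrow> f x * f y)\<^sup>2) = ?a * ?b"
    unfolding sum_product sum.cartesian_product
    by (intro sum.cong) (auto simp: power_mult_distrib)
  finally have "4 * P\<^sup>2 \<le> real (card ?E) * (4 * (?a * ?b))" by simp
  also have "\<dots> \<le> real (card ?E) * (?a + ?b)\<^sup>2"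
    using zero_le_power2[of "?a - ?b"]
    by (intro mult_left_mono) (auto simp: power2_sum power2_diff)
  finally have "\<mu>\<^sup>2 * (?a + ?b)\<^sup>2 \<le> real (card ?E) * (?a + ?b)\<^sup>2"
    using \<open>\<mu> * (?a + ?b) = 2 * P\<close> by (simp flip: power_mult_distrib)
  moreover have "0 < ?a + ?b"
    using f fin parts(1) sum_squares_pos_iff[of "verts G" f]
    unfolding norm eigenfunction_def by simp
  ultimately show ?thesis by simp
qed

section \<open>The extremal graph\<close>

definition complete_bipartite_minus_star :: "nat \<Rightarrow> nat \<Rightarrow> nat \<Rightarrow> (nat + nat) ugraph" where
  "complete_bipartite_minus_star s t p =
     delete_edges_of (complete_bipartite s t) (complete_bipartite 1 p)"

lemma verts_complete_bipartite_minus_star: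
  "verts (complete_bipartite_minus_star s t p) = Inl ` {..<s} \<union> Inr ` {..<t}"
  by (auto simp: complete_bipartite_minus_star_def delete_edges_of_def complete_bipartite_def)

lemma edge_complete_bipartite_minus_star:
  "{Inl i, Inr j} \<in> edges (complete_bipartite_minus_star s t p) \<longleftrightarrow>
     i < s \<and> j < t \<and> (i = 0 \<longrightarrow> p \<le> j)"
  by (auto simp: complete_bipartite_minus_star_def delete_edges_of_def complete_bipartite_def
      doubleton_eq_iff)

lemma bipartition_complete_bipartite_minus_star:
  "bipartition (complete_bipartite_minus_star s t p) (Inl ` {..<s}) (Inr ` {..<t})"
  unfolding bipartition_def verts_complete_bipartite_minus_star
  by (auto simp: complete_bipartite_minus_star_def delete_edges_of_def complete_bipartite_def)

definition star_weights :: "real \<Rightarrow> real \<Rightarrow> real \<Rightarrow> nat + nat \<Rightarrow> real" where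
  "star_weights a b c = case_sum (\<lambda>i. if i = 0 then a else b) (\<lambda>_. c)"

lemma adjacency_form_star_weights:
  assumes s: "0 < s" and p: "p \<le> t"
  shows "adjacency_form (complete_bipartite_minus_star s t p) (star_weights a b c) =
    2 * c * (a * (real t - real p) + b * (real s - 1) * real t)"
proof -
  let ?H = "complete_bipartite_minus_star s t p" and ?f = "star_weights a b c"
  let ?X = "Inl ` {1..<s}" and ?Y = "Inr ` {..<t}"
  have rel: "bip_rel ?H (Inl ` {..<s}) ?Y = ?X \<times> ?Y \<union> {Inl 0} \<times> Inr ` {p..<t}"
    using s by (auto simp: bip_rel_def edge_complete_bipartite_minus_star)
  have product: "(\<Sum>(x, y)\<in>A \<times> B. ?f x * ?f y) = sum ?f A * sum ?f B" for A B
    by (simp add: sum_product sum.cartesian_product)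
  have "sum ?f ?X = (real s - 1) * b" "sum ?f ?Y = real t * c" "?f (Inl 0) = a"
    "sum ?f (Inr ` {p..<t}) = (real t - real p) * c"
    using s p by (simp_all add: star_weights_def sum.reindex of_nat_diff)
  moreover have "(\<Sum>(x, y)\<in>bip_rel ?H (Inl ` {..<s}) ?Y. ?f x * ?f y) =
      sum ?f ?X * sum ?f ?Y + sum ?f {Inl 0} * sum ?f (Inr ` {p..<t})"
    unfolding rel product[symmetric] by (rule sum.union_disjoint) auto
  ultimately have "(\<Sum>(x, y)\<in>bip_rel ?H (Inl ` {..<s}) ?Y. ?f x * ?f y) =
      (real s - 1) * b * (real t * c) + a * ((real t - real p) * c)"
    by simp
  then show ?thesis
    using adjacency_form_bipartite[OF _ _ bipartition_complete_bipartite_minus_star, of s t p ?f]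
    by (simp add: algebra_simps)
qed

lemma sum_squares_star_weights:
  assumes "0 < s"
  shows "sum_squares (verts (complete_bipartite_minus_star s t p)) (star_weights a b c) =
    a\<^sup>2 + (real s - 1) * b\<^sup>2 + real t * c\<^sup>2"
proof -
  have "sum_squares (Inl ` {..<s}) (star_weights a b c) = a\<^sup>2 + (real s - 1) * b\<^sup>2"
    using assms sum.remove[of "{..<s}" 0 "\<lambda>i. (star_weights a b c (Inl i))\<^sup>2"]
    by (simp add: star_weights_def sum.reindex of_nat_diff)
  moreover have "sum_squares (Inr ` {..<t}) (star_weights a b c) = real t * c\<^sup>2"
    by (simp add: star_weights_def sum.reindex)
  ultimately show ?thesis
    unfolding verts_complete_bipartite_minus_star by (subst sum.union_disjoint) auto
qed

text \<open>The test vector extends the Perron vector of \<open>K\<^bsub>s-1,t\<^esub>\<close> by a small positive value at the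
  centre of the deleted star.\<close>

lemma spectral_radius_complete_bipartite_minus_star_gt:
  assumes s: "2 \<le> s" and p: "p < t"
  shows "sqrt (real (s - 1) * real t) < graph_spectral_radius (complete_bipartite_minus_star s t p)"
proof -
  let ?H = "complete_bipartite_minus_star s t p"
  define \<mu> where "\<mu> = sqrt (real (s - 1) * real t)"
  define N where "N = 1 + 2 * ((real s - 1) * (real t)\<^sup>2)"
  have \<mu>: "0 < \<mu>" "\<mu>\<^sup>2 = (real s - 1) * real t" using s p by (auto simp: \<mu>_def of_nat_diff)
  have "N > 0" using s by (simp add: N_def add_pos_nonneg)
  have norm: "sum_squares (verts ?H) (star_weights 1 (real t) \<mu>) = N"
    using s unfolding sum_squares_star_weights[OF order_less_le_trans[OF pos2 s]] \<mu>(2)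
    by (simp add: N_def power2_eq_square algebra_simps)
  have "1 \<le> real t - real p" using p by linarith
  then have "N < 2 * (real t - real p + real t * (real s - 1) * real t)"
    by (simp add: N_def power2_eq_square algebra_simps)
  then have "\<mu> * N < \<mu> * (2 * (real t - real p + real t * (real s - 1) * real t))"
    using \<mu>(1) by (rule mult_strict_left_mono)
  also have "\<dots> = adjacency_form ?H (star_weights 1 (real t) \<mu>)"
    using s p by (simp add: adjacency_form_star_weights)
  also have "\<dots> \<le> graph_spectral_radius ?H * N"
    unfolding norm[symmetric]
  proof (rule graph_spectral_radius_Rayleigh(2))
    show "finite (verts ?H)" by (simp add: verts_complete_bipartite_minus_star)
    have "Inl 0 \<in> verts ?H" using s by (simp add: verts_complete_bipartite_minus_star)
    then show "verts ?H \<noteq> {}" by blast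
  qed
  finally show ?thesis using \<open>N > 0\<close> by (simp add: \<mu>_def)
qed

lemma ex_bij_betw_lessThan_initial_segment:
  assumes fin: "finite Y" and Z: "Z \<subseteq> Y"
  shows "\<exists>h. bij_betw h Y {..<card Y} \<and> (\<forall>y\<in>Y. h y < card Z \<longleftrightarrow> y \<in> Z)"
proof -
  have finZ: "finite Z" using Z fin by (rule finite_subset)
  have card_le: "card Z \<le> card Y" using fin Z by (rule card_mono)
  obtain f where f: "bij_betw f Z {..<card Z}"
    using finZ by (metis card_lessThan finite_lessThan finite_same_card_bij)
  obtain g where g: "bij_betw g (Y - Z) {card Z..<card Y}"
    using fin finZ Z
    by (metis card_Diff_subset card_atLeastLessThan finite_Diff finite_atLeastLessThan
        finite_same_card_bij)
  let ?h = "\<lambda>y. if y \<in> Z then f y else g y"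
  have "bij_betw ?h Z {..<card Z}" using f by (rule bij_betw_cong[THEN iffD1, rotated]) simp
  moreover have "bij_betw ?h (Y - Z) {card Z..<card Y}"
    using g by (rule bij_betw_cong[THEN iffD1, rotated]) simp
  ultimately have "bij_betw ?h (Z \<union> (Y - Z)) ({..<card Z} \<union> {card Z..<card Y})"
    by (rule bij_betw_combine) auto
  moreover have "Z \<union> (Y - Z) = Y" "{..<card Z} \<union> {card Z..<card Y} = {..<card Y}"
    using Z card_le by auto
  moreover have "?h y < card Z \<longleftrightarrow> y \<in> Z" if "y \<in> Y" for y
    using that bij_betwE[OF f] bij_betwE[OF g] by (cases "y \<in> Z") force+
  ultimately show ?thesis by auto
qed

lemma low_degree_bijective_hom:
  assumes fin: "finite X" "finite Y" and cards: "card X = s" "card Y = t"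
    and bip: "bipartition G X Y" and x: "x \<in> X" and deg: "card (bip_rel G X Y `` {x}) + p \<le> t"
  shows "\<exists>\<phi>. bij_betw \<phi> (verts G) (verts (complete_bipartite_minus_star s t p)) \<and>
    (\<forall>u v. {u, v} \<in> edges G \<longrightarrow> {\<phi> u, \<phi> v} \<in> edges (complete_bipartite_minus_star s t p))"
proof -
  let ?H = "complete_bipartite_minus_star s t p"
  have parts: "X \<union> Y = verts G" "X \<inter> Y = {}" using bip by (auto simp: bipartition_def)
  have "bip_rel G X Y `` {x} \<subseteq> Y" using bip_rel_subset by blast
  then have "p \<le> card (Y - bip_rel G X Y `` {x})"
    using deg cards(2) fin(2) by (simp add: card_Diff_subset finite_subset)
  then obtain Z where "Z \<subseteq> Y - bip_rel G X Y `` {x}" and card_Z: "card Z = p"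
    using obtain_subset_with_card_n by metis
  then have Z: "Z \<subseteq> Y" "Z \<inter> bip_rel G X Y `` {x} = {}" by auto
  obtain h where h: "bij_betw h X {..<s}" "\<forall>u\<in>X. h u < 1 \<longleftrightarrow> u = x"
    using ex_bij_betw_lessThan_initial_segment[OF fin(1), of "{x}"] x cards(1) by auto
  obtain g where g: "bij_betw g Y {..<t}" "\<forall>v\<in>Y. g v < p \<longleftrightarrow> v \<in> Z"
    using ex_bij_betw_lessThan_initial_segment[OF fin(2) Z(1)] cards(2) card_Z by auto
  define \<phi> where "\<phi> u = (if u \<in> X then Inl (h u) else Inr (g u))" for u
  have \<phi>_X: "\<phi> u = Inl (h u)" if "u \<in> X" for u using that by (simp add: \<phi>_def)
  have \<phi>_Y: "\<phi> u = Inr (g u)" if "u \<in> Y" for u using that parts(2) by (auto simp: \<phi>_def)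
  have "bij_betw \<phi> X (Inl ` {..<s})" "bij_betw \<phi> Y (Inr ` {..<t})"
    using h(1) g(1) \<phi>_X \<phi>_Y by (auto simp: bij_betw_def inj_on_def image_iff)
  then have bij: "bij_betw \<phi> (verts G) (verts ?H)"
    unfolding parts(1)[symmetric] verts_complete_bipartite_minus_star
    by (rule bij_betw_combine) auto
  have hom: "{\<phi> u, \<phi> v} \<in> edges ?H"
    if uv: "u \<in> X" "v \<in> Y" "{u, v} \<in> edges G" for u v
  proof -
    have "h u < s" "g v < t" using uv bij_betwE[OF h(1)] bij_betwE[OF g(1)] by auto
    moreover have "p \<le> g v" if "h u = 0"
    proof -
      have "u = x" using h(2) uv(1) that by auto
      then have "v \<notin> Z" using Z(2) uv by (auto simp: bip_rel_def)
      then show ?thesis using g(2) uv(2) by (meson not_le)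
    qed
    ultimately show ?thesis
      using uv by (simp add: \<phi>_X \<phi>_Y edge_complete_bipartite_minus_star)
  qed
  have "{\<phi> u, \<phi> v} \<in> edges ?H" if "{u, v} \<in> edges G" for u v
    using bip that hom by (rule bipartition_hom)
  with bij show ?thesis by blast
qed

lemma low_degree_spectral_radius_less:
  assumes sg: "simple_graph G" and conn: "connected_graph G"
    and bip: "bipartition G X Y" and cards: "card X = s" "card Y = t"
    and x: "x \<in> X" and deg: "card (bip_rel G X Y `` {x}) + p \<le> t"
    and not_iso: "\<not> graph_isomorphic G (complete_bipartite_minus_star s t p)"
  shows "graph_spectral_radius G < graph_spectral_radius (complete_bipartite_minus_star s t p)"
    (is "_ < graph_spectral_radius ?H")
proof -
  have fin: "finite X" "finite Y"
    using sg bip by (auto simp: simple_graph_def bipartition_def intro: finite_subset)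
  obtain \<phi> where bij: "bij_betw \<phi> (verts G) (verts ?H)"
    and hom: "\<forall>u v. {u, v} \<in> edges G \<longrightarrow> {\<phi> u, \<phi> v} \<in> edges ?H"
    using low_degree_bijective_hom[OF fin cards bip x deg] by blast
  show ?thesis
    by (rule spectral_radius_less_of_bijective_hom[OF sg conn bij _ not_iso]) (use hom in blast)
qed

lemma few_edges_spectral_radius_less:
  assumes sg: "simple_graph G" and ne: "verts G \<noteq> {}" and bip: "bipartition G X Y"
    and few: "card (bip_rel G X Y) \<le> (s - 1) * t" and s: "2 \<le> s" and p: "p < t"
  shows "graph_spectral_radius G < graph_spectral_radius (complete_bipartite_minus_star s t p)"
proof -
  have fin: "finite (verts G)" "finite X" "finite Y"
    using sg bip by (auto simp: simple_graph_def bipartition_def intro: finite_subset)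
  obtain f where "graph_eigenfunction G (graph_spectral_radius G) f"
    using graph_spectral_radius_Rayleigh(1)[OF fin(1) ne] by blast
  then have "(graph_spectral_radius G)\<^sup>2 \<le> real (card (bip_rel G X Y))"
    by (rule bipartite_eigenvalue_square_le_card_edges[OF fin(2,3) bip])
  also have "\<dots> \<le> real (s - 1) * real t" using few by (metis of_nat_le_iff of_nat_mult)
  finally have "graph_spectral_radius G \<le> sqrt (real (s - 1) * real t)" by (rule real_le_rsqrt)
  also have "\<dots> < graph_spectral_radius (complete_bipartite_minus_star s t p)"
    using s p by (rule spectral_radius_complete_bipartite_minus_star_gt)
  finally show ?thesis .
qed

theorem no_disjoint_perfect_matchings_spectral_radius_less:
  assumes sg: "simple_graph G" and conn: "connected_graph G"
    and bip: "bipartition G X Y" and cards: "card X = m" "card Y = m" and k: "2 \<le> k" "k < m"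
    and no_matchings: "\<not> has_edge_disjoint_perfect_matchings G k"
    and not_iso: "\<not> graph_isomorphic G (complete_bipartite_minus_star m m (m - k + 1))"
  shows "graph_spectral_radius G
    < graph_spectral_radius (complete_bipartite_minus_star m m (m - k + 1))"
proof -
  have fin: "finite X" "finite Y"
    using sg bip by (auto simp: simple_graph_def bipartition_def intro: finite_subset)
  have "\<not> cut_condition X Y (\<lambda>_. k) (\<lambda>_. k) (bip_rel G X Y)"
    using cut_condition_imp_edge_disjoint_perfect_matchings[OF fin _ bip] cards no_matchings by auto
  then consider (low_X) x where "x \<in> X" "card (bip_rel G X Y `` {x}) < k"
    | (low_Y) y where "y \<in> Y" "card (bip_rel G Y X `` {y}) < k"
    | (few_edges) "card (bip_rel G X Y) \<le> (m - 1) * m"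
    using cut_violation_low_degree_or_few_edges[OF fin cards bip_rel_subset k(2)]
    unfolding converse_bip_rel by blast
  then show ?thesis
  proof cases
    case (low_X x)
    then have "card (bip_rel G X Y `` {x}) + (m - k + 1) \<le> m" using k by linarith
    then show ?thesis
      by (rule low_degree_spectral_radius_less[OF sg conn bip cards low_X(1) _ not_iso])
  next
    case (low_Y y)
    then have "card (bip_rel G Y X `` {y}) + (m - k + 1) \<le> m" using k by linarith
    then show ?thesis
      by (rule low_degree_spectral_radius_less[OF sg conn bipartition_sym[OF bip] cards(2,1)
            low_Y(1) _ not_iso])
  next
    case few_edges
    have "verts G \<noteq> {}" using conn by (simp add: connected_graph_def)
    then show ?thesis
      by (rule few_edges_spectral_radius_less[OF sg _ bip few_edges]) (use k in auto)
  qed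
qed

theorem corollary1p4:
  fixes G :: "'a ugraph" and n k :: nat
  assumes "even n" and "n > 0"
    and "2 \<le> k" and "k \<le> n div 2 - 1"
    and "simple_graph G" and "connected_graph G" and "balanced_bipartite G"
    and "card (verts G) = n"
    and "graph_spectral_radius G \<ge>
      graph_spectral_radius
        (delete_edges_of (complete_bipartite (n div 2) (n div 2))
          (complete_bipartite 1 (n div 2 - k + 1)))"
    and "\<not> graph_isomorphic G
      (delete_edges_of (complete_bipartite (n div 2) (n div 2))
        (complete_bipartite 1 (n div 2 - k + 1)))"
  shows "has_edge_disjoint_perfect_matchings G k"
proof (rule ccontr)
  assume no_matchings: "\<not> has_edge_disjoint_perfect_matchings G k"
  define m where "m = n div 2"
  have k: "2 \<le> k" "k < m" using assms(3,4) by (auto simp: m_def)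
  obtain X Y where bip: "bipartition G X Y" and balanced: "card X = card Y"
    using assms(7) by (auto simp: balanced_bipartite_def)
  have "card X + card Y = n"
    using bip assms(5,8) unfolding bipartition_def simple_graph_def
    by (metis card_Un_disjoint finite_Un)
  then have cards: "card X = m" "card Y = m" using balanced by (auto simp: m_def)
  have "graph_spectral_radius G
      < graph_spectral_radius (complete_bipartite_minus_star m m (m - k + 1))"
    by (rule no_disjoint_perfect_matchings_spectral_radius_less
          [OF assms(5,6) bip cards k no_matchings])
      (use assms(10) in \<open>simp add: complete_bipartite_minus_star_def m_def\<close>)
  then show False using assms(9) by (simp add: complete_bipartite_minus_star_def m_def)
qed

end
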